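(* For all sets $X,Y$, every $r\colon X\times Y\to\mathcal V$, and all $a\in FX$, $b\in FY$: $$\mathbf L_\Lambda r(a,b)=\mathbf K_{S^\Lambda}r(a,b).$$
   Context: Let $\mathcal V=[0,1]$ with the usual order, with $\vee,\wedge$ denoting sup and inf. Let $x\ominus y=\max(x-y,0)$. Subsets are identified with $2$-valued predicates. Let $F\colon\mathbf{Set}\to\mathbf{Set}$ be a functor. A $2$-to-$\mathcal V$ predicate lifting $\lambda$ for $F$ is a family $\lambda_X\colon 2^X\to\mathcal V^{FX}$ satisfying naturality: $\lambda_Y(A)(Ff(a))=\lambda_X(f^{-1}[A])(a)$ for all $f\colon X\to Y$, $A\subseteq Y$, $a\in FX$. It is monotone if $A\subseteq B$ implies $\lambda_X(A)\le\lambda_X(B)$ pointwise. Fix a set $\Lambda$ of monotone $2$-to-$\mathcal V$ predicate liftings. For $R\subseteq X\times Y$ put $R[A]=\{y\mid\exists x\in A.\ xRy\}$. Define $a\,(L_{\epsilon,\Lambda}R)\,b$ iff $\lambda_Y(R[A])(b)\ge\lambda_X(A)(a)-\epsilon$ for all $\lambda\in\Lambda$ and $A\subseteq X$. For $r\colon X\times Y\to\mathcal V$ put $r_\epsilon=\{(x,y)\mid r(x,y)\le\epsilon\}$ and $$\mathbf L_\Lambda r(a,b)=\bigwedge\{\epsilon\in\mathcal V\mid a\,(L_{\epsilon,\Lambda}r_\epsilon)\,b\}.$$ For $f\colon X\to\mathcal V$ and $\epsilon\in\mathcal V$ let $f_\epsilon=\{x\mid f(x)\ge\epsilon\}$. The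 Sugeno modality of $\lambda$ is $$S^\lambda_X(f)(a)=\bigvee_{\epsilon\in\mathcal V}\epsilon\wedge\lambda_X(f_\epsilon)(a),$$ and $S^\Lambda=\{S^\lambda\mid\lambda\in\Lambda\}$. Given $r\colon X\times Y\to\mathcal V$, a pair $(f,g)$ with $f\colon X\to\mathcal V$, $g\colon Y\to\mathcal V$ is $r$-preserved if $g(y)\ge f(x)-r(x,y)$ for all $x,y$. The Kantorovich extension is $$\mathbf K_{S^\Lambda}r(a,b)=\bigvee\{S^\lambda_X(f)(a)\ominus S^\lambda_Y(g)(b)\mid\lambda\in\Lambda,\ (f,g)\ r\text{-preserved}\}.$$ *)

theory Defs
  imports Complex_Main "HOL-Library.FuncSet"
begin

section \<open>The complete lattice \<open>\<V> = [0,1]\<close>\<close>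

typedef unit_ival = "{0..1::real}"
  morphisms val mk_ival
  by (rule exI[of _ 0]) simp

lemma val_bounds: "0 \<le> val x" "val x \<le> 1"
  using val[of x] by auto

lemma val_mk_ival: "0 \<le> z \<Longrightarrow> z \<le> 1 \<Longrightarrow> val (mk_ival z) = z"
  by (simp add: mk_ival_inverse)

text \<open>Inserting 0 (resp. 1) under the real supremum (resp. infimum) changes nothing for nonempty
  sets and yields the least (resp. greatest) element for the empty set.\<close>

instantiation unit_ival :: complete_linorder
begin

definition less_eq_unit_ival :: "unit_ival \<Rightarrow> unit_ival \<Rightarrow> bool" where
  "x \<le> y \<longleftrightarrow> val x \<le> val y"

definition less_unit_ival :: "unit_ival \<Rightarrow> unit_ival \<Rightarrow> bool" where
  "x < y \<longleftrightarrow> val x < val y"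

definition inf_unit_ival :: "unit_ival \<Rightarrow> unit_ival \<Rightarrow> unit_ival" where
  "inf x y = mk_ival (min (val x) (val y))"

definition sup_unit_ival :: "unit_ival \<Rightarrow> unit_ival \<Rightarrow> unit_ival" where
  "sup x y = mk_ival (max (val x) (val y))"

definition bot_unit_ival :: unit_ival where
  "bot = mk_ival 0"

definition top_unit_ival :: unit_ival where
  "top = mk_ival 1"

definition Inf_unit_ival :: "unit_ival set \<Rightarrow> unit_ival" where
  "Inf A = mk_ival (Inf (insert 1 (val ` A)))"

definition Sup_unit_ival :: "unit_ival set \<Rightarrow> unit_ival" where
  "Sup A = mk_ival (Sup (insert 0 (val ` A)))"

instance
proof
  fix x y z :: unit_ival and A :: "unit_ival set"
  have bb: "bdd_below (insert 1 (val ` A))"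
    by (rule bdd_belowI[of _ 0]) (auto simp: val_bounds)
  have ba: "bdd_above (insert 0 (val ` A))"
    by (rule bdd_aboveI[of _ 1]) (auto simp: val_bounds)
  have vInf: "val (Inf A) = Inf (insert 1 (val ` A))"
    unfolding Inf_unit_ival_def
    by (rule val_mk_ival)
       (auto intro!: cInf_greatest cInf_lower[OF _ bb] simp: val_bounds)
  have vSup: "val (Sup A) = Sup (insert 0 (val ` A))"
    unfolding Sup_unit_ival_def
    by (rule val_mk_ival)
       (auto intro!: cSup_least cSup_upper[OF _ ba] simp: val_bounds)
  show "(x < y) = (x \<le> y \<and> \<not> y \<le> x)" "x \<le> x" "x \<le> y \<or> y \<le> x"
    by (auto simp: less_eq_unit_ival_def less_unit_ival_def)
  show "x \<le> z" if "x \<le> y" "y \<le> z"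
    using that by (simp add: less_eq_unit_ival_def)
  show "x = y" if "x \<le> y" "y \<le> x"
    using that by (simp add: less_eq_unit_ival_def val_inject flip: val_inject)
  show "inf x y \<le> x" "inf x y \<le> y" "x \<le> sup x y" "y \<le> sup x y"
    by (simp_all add: less_eq_unit_ival_def inf_unit_ival_def sup_unit_ival_def
        val_mk_ival val_bounds min_def max_def)
  show "x \<le> inf y z" if "x \<le> y" "x \<le> z"
    using that by (simp add: less_eq_unit_ival_def inf_unit_ival_def val_mk_ival val_bounds min_def)
  show "sup y z \<le> x" if "y \<le> x" "z \<le> x"
    using that by (simp add: less_eq_unit_ival_def sup_unit_ival_def val_mk_ival val_bounds max_def)
  show "Inf A \<le> x" if "x \<in> A"
    using that by (auto simp: less_eq_unit_ival_def vInf intro!: cInf_lower[OF _ bb])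
  show "z \<le> Inf A" if "\<And>x. x \<in> A \<Longrightarrow> z \<le> x"
    using that by (auto simp: less_eq_unit_ival_def vInf val_bounds intro!: cInf_greatest)
  show "x \<le> Sup A" if "x \<in> A"
    using that by (auto simp: less_eq_unit_ival_def vSup intro!: cSup_upper[OF _ ba])
  show "Sup A \<le> z" if "\<And>x. x \<in> A \<Longrightarrow> x \<le> z"
    using that by (auto simp: less_eq_unit_ival_def vSup val_bounds intro!: cSup_least)
  show "Inf {} = (top :: unit_ival)" "Sup {} = (bot :: unit_ival)"
    by (simp_all add: Inf_unit_ival_def Sup_unit_ival_def top_unit_ival_def bot_unit_ival_def)
qed

end

definition ominus :: "unit_ival \<Rightarrow> unit_ival \<Rightarrow> unit_ival"  (infixl \<open>\<ominus>\<close> 65) where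
  "x \<ominus> y = mk_ival (max (val x - val y) 0)"


section \<open>Set functors and predicate liftings\<close>

text \<open>
  HOL cannot quantify over type constructors, so sets are the subsets of an arbitrary type \<open>'u\<close>
  (the empty set included), and the values of the functor are subsets of an arbitrary type \<open>'v\<close>.
  A map from \<open>X\<close> to \<open>Y\<close> is an element of \<open>X \<rightarrow>\<^sub>E Y\<close>; extensionality makes this a
  one-to-one encoding of set-theoretic functions. \<open>Fmap\<close> carries domain and codomain, since
  a function alone does not determine its codomain.
\<close>

locale set_functor =
  fixes Fob :: "'u set \<Rightarrow> 'v set"
    and Fmap :: "'u set \<Rightarrow> 'u set \<Rightarrow> ('u \<Rightarrow> 'u) \<Rightarrow> 'v \<Rightarrow> 'v"
  assumes Fmap_in: "f \<in> X \<rightarrow>\<^sub>E Y \<Longrightarrow> Fmap X Y f \<in> Fob X \<rightarrow>\<^sub>E Fob Y"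
    and Fmap_id: "Fmap X X (\<lambda>x\<in>X. x) = (\<lambda>a\<in>Fob X. a)"
    and Fmap_comp: "f \<in> X \<rightarrow>\<^sub>E Y \<Longrightarrow> g \<in> Y \<rightarrow>\<^sub>E Z \<Longrightarrow>
      Fmap X Z (compose X g f) = compose (Fob X) (Fmap Y Z g) (Fmap X Y f)"

text \<open>A family \<open>\<lambda>\<^sub>X : 2\<^sup>X \<rightarrow> \<V>\<^sup>F\<^sup>X\<close> is a function taking \<open>X\<close>, a subset \<open>A\<close> of \<open>X\<close> and
  an element of \<open>Fob X\<close>; its values at other arguments are junk and never consulted.\<close>

type_synonym ('u, 'v) pred_family = "'u set \<Rightarrow> 'u set \<Rightarrow> 'v \<Rightarrow> unit_ival"

definition predicate_lifting ::
    "('u set \<Rightarrow> 'v set) \<Rightarrow> ('u set \<Rightarrow> 'u set \<Rightarrow> ('u \<Rightarrow> 'u) \<Rightarrow> 'v \<Rightarrow> 'v) \<Rightarrow>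
     ('u, 'v) pred_family \<Rightarrow> bool" where
  "predicate_lifting Fob Fmap l \<longleftrightarrow>
     (\<forall>X Y. \<forall>f \<in> X \<rightarrow>\<^sub>E Y. \<forall>A \<subseteq> Y. \<forall>a \<in> Fob X.
        l Y A (Fmap X Y f a) = l X (f -` A \<inter> X) a)"

definition monotone_lifting :: "('u set \<Rightarrow> 'v set) \<Rightarrow> ('u, 'v) pred_family \<Rightarrow> bool" where
  "monotone_lifting Fob l \<longleftrightarrow>
     (\<forall>X A B. A \<subseteq> B \<longrightarrow> B \<subseteq> X \<longrightarrow> (\<forall>a \<in> Fob X. l X A a \<le> l X B a))"


section \<open>The lax extension \<open>\<^bold>L\<close>\<close>

definition rel_ext ::
    "('u, 'v) pred_family set \<Rightarrow> 'u set \<Rightarrow> 'u set \<Rightarrow> unit_ival \<Rightarrow> ('u \<times> 'u) set \<Rightarrow>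
     'v \<Rightarrow> 'v \<Rightarrow> bool" where
  "rel_ext \<Lambda> X Y \<epsilon> R a b \<longleftrightarrow>
     (\<forall>l \<in> \<Lambda>. \<forall>A \<subseteq> X. val (l Y (R `` A) b) \<ge> val (l X A a) - val \<epsilon>)"

text \<open>Fuzzy relations and fuzzy predicates are total functions on the type; only their restrictions
  to \<open>X \<times> Y\<close> resp. \<open>X\<close> are used below.\<close>

definition rel_cut ::
    "'u set \<Rightarrow> 'u set \<Rightarrow> ('u \<Rightarrow> 'u \<Rightarrow> unit_ival) \<Rightarrow> unit_ival \<Rightarrow> ('u \<times> 'u) set" where
  "rel_cut X Y r \<epsilon> = {(x, y). x \<in> X \<and> y \<in> Y \<and> r x y \<le> \<epsilon>}"

definition lax_ext ::
    "('u, 'v) pred_family set \<Rightarrow> 'u set \<Rightarrow> 'u set \<Rightarrow> ('u \<Rightarrow> 'u \<Rightarrow> unit_ival) \<Rightarrow>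
     'v \<Rightarrow> 'v \<Rightarrow> unit_ival" where
  "lax_ext \<Lambda> X Y r a b = Inf {\<epsilon>. rel_ext \<Lambda> X Y \<epsilon> (rel_cut X Y r \<epsilon>) a b}"


section \<open>Sugeno modalities and the Kantorovich extension\<close>

type_synonym ('u, 'v) fuzzy_family = "'u set \<Rightarrow> ('u \<Rightarrow> unit_ival) \<Rightarrow> 'v \<Rightarrow> unit_ival"

definition pred_cut :: "'u set \<Rightarrow> ('u \<Rightarrow> unit_ival) \<Rightarrow> unit_ival \<Rightarrow> 'u set" where
  "pred_cut X f \<epsilon> = {x \<in> X. f x \<ge> \<epsilon>}"

definition sugeno :: "('u, 'v) pred_family \<Rightarrow> ('u, 'v) fuzzy_family" where
  "sugeno l X f a = (SUP \<epsilon>. inf \<epsilon> (l X (pred_cut X f \<epsilon>) a))"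

definition preserved ::
    "'u set \<Rightarrow> 'u set \<Rightarrow> ('u \<Rightarrow> 'u \<Rightarrow> unit_ival) \<Rightarrow>
     ('u \<Rightarrow> unit_ival) \<Rightarrow> ('u \<Rightarrow> unit_ival) \<Rightarrow> bool" where
  "preserved X Y r f g \<longleftrightarrow> (\<forall>x \<in> X. \<forall>y \<in> Y. val (g y) \<ge> val (f x) - val (r x y))"

definition kantorovich ::
    "('u, 'v) fuzzy_family set \<Rightarrow> 'u set \<Rightarrow> 'u set \<Rightarrow> ('u \<Rightarrow> 'u \<Rightarrow> unit_ival) \<Rightarrow>
     'v \<Rightarrow> 'v \<Rightarrow> unit_ival" where
  "kantorovich M X Y r a b =
     Sup {m X f a \<ominus> m Y g b | m f g. m \<in> M \<and> preserved X Y r f g}"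

end

theory Submission imports Defs begin

text \<open>
  If \<open>\<epsilon>\<close> is admissible for the lax extension and \<open>(f, g)\<close> is \<open>r\<close>-preserved, then the image of the
  cut \<open>f\<^sub>\<delta>\<close> under \<open>r\<^sub>\<epsilon>\<close> lies in the cut of \<open>g\<close> at \<open>\<delta> - \<epsilon>\<close>; by monotonicity the Sugeno modality
  drops by at most \<open>\<epsilon>\<close> from \<open>f\<close> to \<open>g\<close>. Conversely, if admissibility of \<open>\<epsilon>\<close> fails at \<open>A\<close> with
  \<open>u = \<lambda>\<^sub>X(A)(a)\<close>, then the two-valued predicates \<open>f\<close> (equal to \<open>u\<close> on \<open>A\<close>, \<open>0\<close> elsewhere) and \<open>g\<close>
  (equal to \<open>u\<close> on \<open>r\<^sub>\<epsilon>[A]\<close>, \<open>u - \<epsilon>\<close> elsewhere) form an \<open>r\<close>-preserved pair whose Sugeno values differ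
  by at least \<open>\<epsilon>\<close>.
\<close>

lemma val_inf: "val (inf x y) = min (val x) (val y)"
  by (simp add: inf_unit_ival_def val_mk_ival val_bounds min_def)

lemma val_ominus: "val (x \<ominus> y) = max (val x - val y) 0"
  using val_bounds[of x] val_bounds[of y] by (simp add: ominus_def val_mk_ival)

text \<open>Used to separate the two extensions by an intermediate level, so the infimum need not be
  attained.\<close>

lemma unit_ival_dense:
  fixes x y :: unit_ival
  assumes "x < y"
  obtains z where "x < z" "z < y"
proof -
  obtain t where t: "val x < t" "t < val y"
    using assms dense by (auto simp: less_unit_ival_def)
  then have "val (mk_ival t) = t"
    using val_bounds[of x] val_bounds[of y] by (intro val_mk_ival) auto
  with t show thesis
    by (intro that[of "mk_ival t"]) (simp_all add: less_unit_ival_def)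
qed

lemma ominus_le_iff: "x \<ominus> y \<le> e \<longleftrightarrow> val x \<le> val y + val e"
  using val_bounds[of e] by (auto simp: less_eq_unit_ival_def val_ominus)

lemma le_sugeno: "inf d (l X (pred_cut X f d) a) \<le> sugeno l X f a"
  unfolding sugeno_def by (rule SUP_upper) simp

text \<open>Passing from \<open>x\<close> to \<open>y\<close> along the cut relation costs at most
  \<open>e\<close>. The hypothesis on \<open>d\<close> is an untruncated real equation, hence forces
  \<open>e\<close> \<le> \<open>c\<close>.\<close>

lemma image_rel_cut_subset_pred_cut:
  assumes "preserved X Y r f g" and "val d = val c - val e"
  shows "rel_cut X Y r e `` pred_cut X f c \<subseteq> pred_cut Y g d"
proof
  fix y assume "y \<in> rel_cut X Y r e `` pred_cut X f c"
  then obtain x where x: "x \<in> X" "y \<in> Y" "val c \<le> val (f x)" "val (r x y) \<le> val e"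
    by (auto simp: rel_cut_def pred_cut_def less_eq_unit_ival_def)
  with assms(1) have "val (f x) - val (r x y) \<le> val (g y)"
    by (simp add: preserved_def)
  with x assms(2) show "y \<in> pred_cut Y g d"
    by (simp add: pred_cut_def less_eq_unit_ival_def)
qed

lemma sugeno_ominus_le:
  assumes mono: "monotone_lifting Fob l" and b: "b \<in> Fob Y"
    and ext: "\<And>A. A \<subseteq> X \<Longrightarrow> val (l X A a) - val e \<le> val (l Y (rel_cut X Y r e `` A) b)"
    and pres: "preserved X Y r f g"
  shows "sugeno l X f a \<ominus> sugeno l Y g b \<le> e"
proof -
  let ?s = "val (sugeno l Y g b) + val e"
  have bound: "min (val c) (val (l X (pred_cut X f c) a)) \<le> ?s" for c
  proof (cases "val c \<le> val e")
    \<comment> \<open>Levels up to \<open>e\<close> are absorbed by the summand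
      \<open>val e\<close>; only higher levels can be shifted down by \<open>e\<close>.\<close>
    case True
    then show ?thesis
      using val_bounds(1)[of "sugeno l Y g b"] by linarith
  next
    case False
    define d where "d = mk_ival (val c - val e)"
    have d: "val d = val c - val e"
      using False val_bounds[of c] val_bounds[of e] unfolding d_def
      by (intro val_mk_ival) auto
    have "val (l X (pred_cut X f c) a) - val e
        \<le> val (l Y (rel_cut X Y r e `` pred_cut X f c) b)"
      by (rule ext) (auto simp: pred_cut_def)
    also have "\<dots> \<le> val (l Y (pred_cut Y g d) b)"
    proof -
      have "pred_cut Y g d \<subseteq> Y"
        by (auto simp: pred_cut_def)
      with mono b image_rel_cut_subset_pred_cut[OF pres d]
      show ?thesis
        by (simp add: monotone_lifting_def flip: less_eq_unit_ival_def)
    qed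
    finally show ?thesis
      using le_sugeno[of d l Y g b] d by (auto simp: less_eq_unit_ival_def val_inf)
  qed
  \<comment> \<open>\<open>?s\<close> may exceed 1, so it is capped to give an upper bound inside
    the lattice.\<close>
  have s: "val (mk_ival (min 1 ?s)) = min 1 ?s"
    using val_bounds(1)[of "sugeno l Y g b"] val_bounds(1)[of e] by (intro val_mk_ival) auto
  have "sugeno l X f a \<le> mk_ival (min 1 ?s)"
    unfolding sugeno_def[of l X]
    using bound val_bounds(2)
    by (intro SUP_least) (auto simp: less_eq_unit_ival_def s val_inf min_le_iff_disj)
  then show ?thesis
    unfolding ominus_le_iff by (simp add: less_eq_unit_ival_def s)
qed

lemma exists_preserved_witness:
  assumes mono: "monotone_lifting Fob l" and b: "b \<in> Fob Y"
    and A: "A \<subseteq> X"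
    and fails: "val (l Y (rel_cut X Y r e `` A) b) < val (l X A a) - val e"
  obtains f g where "preserved X Y r f g" "e \<le> sugeno l X f a \<ominus> sugeno l Y g b"
proof -
  let ?u = "l X A a" and ?B = "rel_cut X Y r e `` A"
  \<comment> \<open>The strict failure makes \<open>val ?u - val e\<close> positive, so no
    truncation occurs.\<close>
  define w where "w = mk_ival (val ?u - val e)"
  have w: "val w = val ?u - val e"
    using fails val_bounds[of ?u] val_bounds(1)[of e] val_bounds(1)[of "l Y ?B b"]
    unfolding w_def by (intro val_mk_ival) auto
  have bot: "val bot = 0"
    by (simp add: bot_unit_ival_def val_mk_ival)
  \<comment> \<open>Positivity keeps points outside \<open>A\<close>, where \<open>f\<close> is 0,
    out of the cut of \<open>f\<close> at \<open>?u\<close>.\<close>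
  have u: "0 < val ?u"
    using fails val_bounds(1)[of e] val_bounds(1)[of "l Y ?B b"] by linarith
  define f where "f x = (if x \<in> A then ?u else bot)" for x
  define g where "g y = (if y \<in> ?B then ?u else w)" for y
  have pres: "preserved X Y r f g"
    unfolding preserved_def
  proof (intro ballI)
    fix x y assume xy: "x \<in> X" "y \<in> Y"
    show "val (f x) - val (r x y) \<le> val (g y)"
    proof (cases "x \<in> A \<and> y \<notin> ?B")
      case True
      with xy have "val e < val (r x y)"
        by (auto simp: rel_cut_def less_eq_unit_ival_def)
      with True w show ?thesis
        by (simp add: f_def g_def)
    next
      case False
      then show ?thesis
        using val_bounds(1)[of "r x y"] val_bounds(1)[of w] val_bounds(1)[of ?u]
        by (auto simp: f_def g_def bot)
    qed
  qed
  have "pred_cut X f ?u = A"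
    using A u by (auto simp: pred_cut_def f_def less_eq_unit_ival_def bot)
  then have Sf: "?u \<le> sugeno l X f a"
    using le_sugeno[of ?u l X f a] by simp
  have Sg: "sugeno l Y g b \<le> w"
    unfolding sugeno_def
  proof (rule SUP_least)
    fix d
    show "inf d (l Y (pred_cut Y g d) b) \<le> w"
    proof (cases "d \<le> w")
      case True
      then show ?thesis
        by (rule le_infI1)
    next
      case False
      \<comment> \<open>Outside \<open>?B\<close> the value of \<open>g\<close> is \<open>w\<close>,
        which is below \<open>d\<close>.\<close>
      then have "pred_cut Y g d \<subseteq> ?B"
        by (auto simp: pred_cut_def g_def split: if_splits)
      moreover have "?B \<subseteq> Y"
        by (auto simp: rel_cut_def)
      ultimately have "l Y (pred_cut Y g d) b \<le> l Y ?B b"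
        using mono b by (auto simp: monotone_lifting_def)
      also have "\<dots> \<le> w"
        using fails by (simp add: less_eq_unit_ival_def w)
      finally show ?thesis
        by (rule le_infI2)
    qed
  qed
  have "e \<le> sugeno l X f a \<ominus> sugeno l Y g b"
    using Sf Sg w by (simp add: less_eq_unit_ival_def val_ominus)
  with pres show thesis
    by (rule that)
qed

theorem theorem7p1:
  fixes Fob :: "'u set \<Rightarrow> 'v set"
    and Fmap :: "'u set \<Rightarrow> 'u set \<Rightarrow> ('u \<Rightarrow> 'u) \<Rightarrow> 'v \<Rightarrow> 'v"
    and \<Lambda> :: "('u, 'v) pred_family set"
    and X Y :: "'u set"
    and r :: "'u \<Rightarrow> 'u \<Rightarrow> unit_ival"
    and a b :: 'v
  assumes "set_functor Fob Fmap"
    and "\<And>l. l \<in> \<Lambda> \<Longrightarrow> predicate_lifting Fob Fmap l"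
    and "\<And>l. l \<in> \<Lambda> \<Longrightarrow> monotone_lifting Fob l"
    and "a \<in> Fob X" and "b \<in> Fob Y"
  shows "lax_ext \<Lambda> X Y r a b = kantorovich (sugeno ` \<Lambda>) X Y r a b" (is "?L = ?K")
proof (rule antisym)
  show "?K \<le> ?L"
    unfolding kantorovich_def lax_ext_def
  proof (intro Inf_greatest Sup_least; clarsimp)
    fix e l f g
    assume "rel_ext \<Lambda> X Y e (rel_cut X Y r e) a b" "l \<in> \<Lambda>" "preserved X Y r f g"
    then show "sugeno l X f a \<ominus> sugeno l Y g b \<le> e"
      using assms(3,5) by (intro sugeno_ominus_le[where r = r]) (auto simp: rel_ext_def)
  qed
next
  show "?L \<le> ?K"
  proof (rule ccontr)
    assume "\<not> ?L \<le> ?K"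
    then have "?K < ?L"
      by simp
    then obtain e where e: "?K < e" "e < ?L"
      by (rule unit_ival_dense)
    \<comment> \<open>An admissible \<open>e\<close> would be an upper bound of the infimum
      \<open>?L\<close>.\<close>
    have "\<not> rel_ext \<Lambda> X Y e (rel_cut X Y r e) a b"
    proof
      assume "rel_ext \<Lambda> X Y e (rel_cut X Y r e) a b"
      then have "?L \<le> e"
        unfolding lax_ext_def by (intro Inf_lower CollectI)
      with e(2) show False
        by simp
    qed
    then obtain l A where l: "l \<in> \<Lambda>" and A: "A \<subseteq> X"
      "val (l Y (rel_cut X Y r e `` A) b) < val (l X A a) - val e"
      by (auto simp: rel_ext_def not_le)
    obtain f g where fg: "preserved X Y r f g" "e \<le> sugeno l X f a \<ominus> sugeno l Y g b"
      by (rule exists_preserved_witness[OF assms(3)[OF l] assms(5) A])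
    have "sugeno l X f a \<ominus> sugeno l Y g b \<le> ?K"
      unfolding kantorovich_def using l fg(1) by (intro Sup_upper) blast
    with fg(2) e(1) show False
      by simp
  qed
qed

end
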